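(* Let $G_1=(V_1,E_1,\sigma_1,\mu_1)$ be any signed graph on $n$ nodes $u_1,\dots,u_n$ and $G_2=(V_2,E_2,\sigma_2,\mu_2)$ a net-regular signed graph on $k$ nodes $v_1,\dots,v_k$ with net-regularity $d$. Let $(\lambda_i,X_i)$, $i=1,\dots,n$, be the adjacency eigenpairs of $G_1$ and $(\eta_j,Y_j)$, $j=1,\dots,k$, the adjacency eigenpairs of $G_2$, with $\eta_k=d$. Then for each $i=1,\dots,n$, $(\lambda^{(i)}_\pm,Z^{(i)}_\pm)$ is an adjacency eigenpair of $G_1\circ G_2$, where $$\lambda^{(i)}_\pm=\frac{d+\lambda_i\pm\sqrt{(d-\lambda_i)^2+4k}}{2},\qquad Z^{(i)}_\pm=\begin{bmatrix}X_i\\ \frac{\mu_2(v_1)}{\lambda^{(i)}_\pm-d}\,\mathrm{diag}(\mu[V_1])X_i\\ \vdots\\ \frac{\mu_2(v_k)}{\lambda^{(i)}_\pm-d}\,\mathrm{diag}(\mu[V_1])X_i\end{bmatrix}.$$ In addition, if all nodes of $G_2$ are positively marked or all are negatively marked (i.e. $\mu[V_2]=\mathbf 1_k$ or $-\mathbf 1_k$), then $\left(\eta_j,\begin{bmatrix}\mathbf 0\\ Y_j\otimes e_i\end{bmatrix}\right)$ is an adjacency eigenpair of $G_1\circ G_2$ for $j=1,\dots,k-1$ and $i=1,\dots,n$, where $\{e_i\}$ is the standard basis of $\mathbb R^n$.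
   Context: A signed graph is $G=(V,E,\sigma,\mu)$ with $\sigma:E\to\{+,-\}$ the edge signs and $\mu:V\to\{+,-\}$ a marking function (canonical marking: $\mu(v)$ is the product of the signs of edges at $v$; or plurality marking: $\mu(v)=+$ iff $d^+(v)\ge d^-(v)$), with marks identified with $\pm1$. Its adjacency matrix $A$ has $a_{ij}=1$ for a positive edge, $-1$ for a negative edge, $0$ otherwise. $G$ is net-regular with net-regularity $d$ if $d^+(v)-d^-(v)=d$ for every node $v$, where $d^\pm(v)$ are the numbers of positive/negative edges at $v$. Corona product $G_1\circ G_2$: one copy of $G_1$ and $n$ copies of $G_2$, with $u_i$ joined to every node of the $i$-th copy of $G_2$, the edge from $u_i$ to the copy of $v_j$ having sign $\mu_1(u_i)\mu_2(v_j)$. Vertices of $G_1\circ G_2$ are ordered as $u_1,\dots,u_n$ followed by $k$ blocks, block $j$ consisting of the copies of $v_j$ in copies $1,\dots,n$; thus $A(G_1\circ G_2)=\begin{bmatrix}A(G_1)&\mu[V_2]\otimes\mathrm{diag}(\mu[V_1])\\ \mu[V_2]^T\otimes\mathrm{diag}(\mu[V_1])&A(G_2)\otimes I_n\end{bmatrix}$, where $\mu[V_2]=(\mu_2(v_1),\dots,\mu_2(v_k))$ (row vector), $\mathrm{diag}(\mu[V_1])$ is the diagonal matrix with entries $\mu_1(u_1),\dots,\mu_1(u_n)$, and $\otimes$ is the Kronecker product. $\mathbf 1_k$ is the all-ones vector.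
   Formalization: Two added hypotheses, without which the claim is false: if G_2 carries the canonical marking, μ[V_2] is assumed to be an eigenvector of A(G_2) for d; and any Y_j (j<k) with η_j=d is assumed orthogonal to the all-ones vector. *)

theory Defs
  imports "HOL-Analysis.Analysis"
begin

text \<open>
  The vertex set of a signed graph is the whole (finite) type \<open>'v\<close>. Signs and marks are the
  real numbers 1 and -1. The values of \<open>esign\<close> on non-adjacent pairs are irrelevant.
\<close>

record 'v sgraph =
  adj :: "'v \<Rightarrow> 'v \<Rightarrow> bool"
  esign :: "'v \<Rightarrow> 'v \<Rightarrow> real"

definition signed_graph :: "'v::finite sgraph \<Rightarrow> bool" where
  "signed_graph G \<longleftrightarrow>
     (\<forall>v. \<not> adj G v v) \<and>
     (\<forall>v w. adj G v w \<longrightarrow> adj G w v \<and> esign G v w \<in> {1, -1} \<and> esign G w v = esign G v w)"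

definition pos_degree :: "'v::finite sgraph \<Rightarrow> 'v \<Rightarrow> nat" where
  "pos_degree G v = card {w. adj G v w \<and> esign G v w = 1}"

definition neg_degree :: "'v::finite sgraph \<Rightarrow> 'v \<Rightarrow> nat" where
  "neg_degree G v = card {w. adj G v w \<and> esign G v w = -1}"

definition net_regular :: "'v::finite sgraph \<Rightarrow> int \<Rightarrow> bool" where
  "net_regular G d \<longleftrightarrow> (\<forall>v. int (pos_degree G v) - int (neg_degree G v) = d)"

definition canonical_marking :: "'v::finite sgraph \<Rightarrow> 'v \<Rightarrow> real" where
  "canonical_marking G v = (\<Prod>w | adj G v w. esign G v w)"

definition plurality_marking :: "'v::finite sgraph \<Rightarrow> 'v \<Rightarrow> real" where
  "plurality_marking G v = (if pos_degree G v \<ge> neg_degree G v then 1 else -1)"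

text \<open>
  The plurality marking of a net-regular graph is constant. The canonical marking need not be,
  and then it need not be an eigenvector of the adjacency matrix: for the two triangles 012 and
  034 with negative edges 12, 03, 04 and positive edges 01, 02, 34, all net degrees are 0, but the
  adjacency matrix maps the canonical marking (1, -1, -1, -1, -1) to (0, 2, 2, -2, -2).
\<close>

definition marking_of :: "'v::finite sgraph \<Rightarrow> ('v \<Rightarrow> real) \<Rightarrow> bool" where
  "marking_of G \<mu> \<longleftrightarrow> \<mu> = canonical_marking G \<or> \<mu> = plurality_marking G"

definition adjacency_matrix :: "'v::finite sgraph \<Rightarrow> real^'v^'v" where
  "adjacency_matrix G = (\<chi> v w. if adj G v w then esign G v w else 0)"

definition eigenpair :: "real^'v^'v \<Rightarrow> real \<Rightarrow> real^'v::finite \<Rightarrow> bool" where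
  "eigenpair A c x \<longleftrightarrow> x \<noteq> 0 \<and> A *v x = c *s x"

text \<open>
  In the corona product, \<open>Inl u\<close> is the vertex \<open>u\<close> of the first graph and \<open>Inr (v, u)\<close> is the
  copy of the vertex \<open>v\<close> of the second graph that belongs to \<open>u\<close>. The component \<open>v\<close> comes first
  because the vertices of the copies are grouped into blocks by \<open>v\<close>.
\<close>

fun corona_adj :: "'a sgraph \<Rightarrow> 'b sgraph \<Rightarrow> 'a + 'b \<times> 'a \<Rightarrow> 'a + 'b \<times> 'a \<Rightarrow> bool" where
  "corona_adj G H (Inl u) (Inl u') \<longleftrightarrow> adj G u u'"
| "corona_adj G H (Inl u) (Inr (v, u')) \<longleftrightarrow> u = u'"
| "corona_adj G H (Inr (v, u)) (Inl u') \<longleftrightarrow> u = u'"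
| "corona_adj G H (Inr (v, u)) (Inr (v', u')) \<longleftrightarrow> u = u' \<and> adj H v v'"

fun corona_sign ::
  "'a sgraph \<Rightarrow> ('a \<Rightarrow> real) \<Rightarrow> 'b sgraph \<Rightarrow> ('b \<Rightarrow> real) \<Rightarrow> 'a + 'b \<times> 'a \<Rightarrow> 'a + 'b \<times> 'a \<Rightarrow> real"
where
  "corona_sign G \<mu> H \<nu> (Inl u) (Inl u') = esign G u u'"
| "corona_sign G \<mu> H \<nu> (Inl u) (Inr (v, u')) = \<mu> u * \<nu> v"
| "corona_sign G \<mu> H \<nu> (Inr (v, u)) (Inl u') = \<mu> u' * \<nu> v"
| "corona_sign G \<mu> H \<nu> (Inr (v, u)) (Inr (v', u')) = esign H v v'"

definition corona ::
  "'a sgraph \<Rightarrow> ('a \<Rightarrow> real) \<Rightarrow> 'b sgraph \<Rightarrow> ('b \<Rightarrow> real) \<Rightarrow> ('a + 'b \<times> 'a) sgraph" where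
  "corona G \<mu> H \<nu> = \<lparr>adj = corona_adj G H, esign = corona_sign G \<mu> H \<nu>\<rparr>"

definition diag_matrix :: "('a \<Rightarrow> real) \<Rightarrow> real^'a^'a::finite" where
  "diag_matrix f = (\<chi> i j. if i = j then f i else 0)"

definition stack :: "real^'a \<Rightarrow> real^('b \<times> 'a) \<Rightarrow> real^('a::finite + 'b::finite \<times> 'a)" where
  "stack x y = (\<chi> p. case p of Inl u \<Rightarrow> x $ u | Inr q \<Rightarrow> y $ q)"

definition blocks :: "('b \<Rightarrow> real^'a) \<Rightarrow> real^('b::finite \<times> 'a::finite)" where
  "blocks f = (\<chi> q. f (fst q) $ snd q)"

definition kron_vec :: "real^'b \<Rightarrow> real^'a \<Rightarrow> real^('b::finite \<times> 'a::finite)" where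
  "kron_vec y x = (\<chi> q. y $ fst q * x $ snd q)"

definition kron_matrix :: "real^'n^'m \<Rightarrow> real^'q^'p \<Rightarrow>
    real^('n::finite \<times> 'q::finite)^('m::finite \<times> 'p::finite)" where
  "kron_matrix A B = (\<chi> p q. A $ fst p $ fst q * B $ snd p $ snd q)"

lemma marking_of_values:
  assumes "signed_graph G" "marking_of G \<mu>"
  shows "\<mu> v \<in> {1, -1}"
proof -
  have "(\<Prod>w\<in>S. esign G v w) \<in> {1, -1}" if "S \<subseteq> {w. adj G v w}" for S
    using finite[of S] that
  proof (induction S rule: finite_induct)
    case (insert w S)
    then have "esign G v w \<in> {1, -1}" "(\<Prod>w\<in>S. esign G v w) \<in> {1, -1}"
      using assms(1) unfolding signed_graph_def by blast+
    then show ?case using insert.hyps by auto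
  qed auto
  from this[OF subset_refl] have "canonical_marking G v \<in> {1, -1}"
    by (simp only: canonical_marking_def)
  moreover have "plurality_marking G v \<in> {1, -1}"
    by (simp add: plurality_marking_def)
  ultimately show ?thesis
    using assms(2) unfolding marking_of_def by blast
qed

lemma signed_graph_corona:
  assumes G: "signed_graph G" and H: "signed_graph H"
    and mu: "marking_of G \<mu>" and nu: "marking_of H \<nu>"
  shows "signed_graph (corona G \<mu> H \<nu>)"
proof -
  have a: "\<not> corona_adj G H p p" for p
    using G H by (cases "(G, H, p, p)" rule: corona_adj.cases) (auto simp: signed_graph_def)
  have b: "corona_adj G H q p \<and> corona_sign G \<mu> H \<nu> p q \<in> {1, -1} \<and>
      corona_sign G \<mu> H \<nu> q p = corona_sign G \<mu> H \<nu> p q" if "corona_adj G H p q" for p q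
  proof -
    have "\<mu> u * \<nu> v \<in> {1, -1}" for u v
      using marking_of_values[OF G mu, of u] marking_of_values[OF H nu, of v] by auto
    then show ?thesis
      using that G H
      by (cases "(G, H, p, q)" rule: corona_adj.cases) (auto simp: signed_graph_def)
  qed
  show ?thesis
    unfolding signed_graph_def corona_def using a b by simp
qed

lemma adjacency_matrix_corona:
  fixes G :: "'a::finite sgraph" and H :: "'b::finite sgraph"
    and \<mu> :: "'a \<Rightarrow> real" and \<nu> :: "'b \<Rightarrow> real"
  defines "A \<equiv> adjacency_matrix (corona G \<mu> H \<nu>)"
  shows "A $ Inl u $ Inl u' = adjacency_matrix G $ u $ u'"
    and "A $ Inl u $ Inr (v, u') = \<nu> v * diag_matrix \<mu> $ u $ u'"
    and "A $ Inr (v, u) $ Inl u' = \<nu> v * diag_matrix \<mu> $ u $ u'"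
    and "A $ Inr p $ Inr q = kron_matrix (adjacency_matrix H) (mat 1) $ p $ q"
  by (cases p; cases q;
      auto simp: A_def adjacency_matrix_def corona_def diag_matrix_def kron_matrix_def mat_def)+

end

theory Submission
  imports Defs
begin

text \<open>
  On vectors whose lower part is \<open>\<mu>[V\<^sub>2] \<otimes> c diag(\<mu>[V\<^sub>1]) x\<close> with \<open>x\<close> an eigenvector
  of \<open>G\<^sub>1\<close> for \<open>\<lambda>\<close>, the eigenvalue equation for \<open>l\<close> becomes \<open>c (l - d) = 1\<close> in the lower blocks,
  because \<open>\<mu>[V\<^sub>2]\<close> is an eigenvector of \<open>G\<^sub>2\<close> for \<open>d\<close>, and \<open>l = \<lambda> + c k\<close> in the upper block, because
  marks square to 1. Thus \<open>l\<close> is a root of \<open>(l - \<lambda>) (l - d) = k\<close>.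
  The remaining eigenvectors come from eigenvectors of \<open>G\<^sub>2\<close> with vanishing coordinate sum.
\<close>

section \<open>Block vectors and their products with the corona matrix\<close>

lemma sum_UNIV_Plus:
  fixes g :: "'a::finite + 'b::finite \<Rightarrow> 'c::comm_monoid_add"
  shows "(\<Sum>p\<in>UNIV. g p) = (\<Sum>u\<in>UNIV. g (Inl u)) + (\<Sum>q\<in>UNIV. g (Inr q))"
  using sum.Plus[of UNIV UNIV g] by simp

lemma sum_UNIV_Times:
  fixes g :: "'a::finite \<times> 'b::finite \<Rightarrow> 'c::comm_monoid_add"
  shows "(\<Sum>q\<in>UNIV. g q) = (\<Sum>v\<in>UNIV. \<Sum>u\<in>UNIV. g (v, u))"
  by (subst UNIV_Times_UNIV[symmetric]) (simp add: sum.cartesian_product)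

lemma diag_matrix_mult_vec_nth:
  fixes x :: "real^'a::finite"
  shows "(diag_matrix f *v x) $ u = f u * x $ u"
  by (simp add: diag_matrix_def matrix_vector_mult_def if_distrib if_distribR cong: if_cong)

lemma stack_nth [simp]: "stack x y $ Inl u = x $ u" "stack x y $ Inr q = y $ q"
  by (simp_all add: stack_def)

lemma blocks_nth [simp]: "blocks f $ (v, u) = f v $ u"
  by (simp add: blocks_def)

text \<open>Brings the second family of eigenvectors into block form, so that the two product
  formulas below serve both families.\<close>

lemma kron_vec_eq_blocks: "kron_vec y x = blocks (\<lambda>v. (y $ v) *s x)"
  by (simp add: kron_vec_def blocks_def vec_eq_iff)

lemma corona_mult_stack_Inl:
  fixes G :: "'a::finite sgraph" and H :: "'b::finite sgraph"
  shows "(adjacency_matrix (corona G \<mu> H \<nu>) *v stack x (blocks f)) $ Inl u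
    = (adjacency_matrix G *v x) $ u + \<mu> u * (\<Sum>v\<in>UNIV. \<nu> v * f v $ u)"
proof -
  have "(\<Sum>u'\<in>UNIV. \<nu> v * diag_matrix \<mu> $ u $ u' * f v $ u') = \<mu> u * (\<nu> v * f v $ u)" for v
    using diag_matrix_mult_vec_nth[of \<mu> "f v" u]
    by (simp add: matrix_vector_mult_def mult.assoc sum_distrib_left[symmetric])
  then show ?thesis
    by (simp add: matrix_vector_mult_def sum_UNIV_Plus sum_UNIV_Times adjacency_matrix_corona
        sum_distrib_left)
qed

text \<open>The factor \<open>mat 1\<close> in the Kronecker product keeps the copies of
  \<open>H\<close> apart: within the lower part, \<open>u\<close> is only a parameter, and
  \<open>H\<close> acts on the index \<open>v\<close>.\<close>

lemma corona_mult_stack_Inr: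
  fixes G :: "'a::finite sgraph" and H :: "'b::finite sgraph"
  shows "(adjacency_matrix (corona G \<mu> H \<nu>) *v stack x (blocks f)) $ Inr (v, u)
    = \<nu> v * (\<mu> u * x $ u) + (\<Sum>v'\<in>UNIV. adjacency_matrix H $ v $ v' * f v' $ u)"
proof -
  have "(\<Sum>u'\<in>UNIV. \<nu> v * diag_matrix \<mu> $ u $ u' * x $ u') = \<nu> v * (\<mu> u * x $ u)"
    using diag_matrix_mult_vec_nth[of \<mu> x u]
    by (simp add: matrix_vector_mult_def mult.assoc sum_distrib_left[symmetric])
  then show ?thesis
    by (simp add: matrix_vector_mult_def sum_UNIV_Plus sum_UNIV_Times adjacency_matrix_corona
        kron_matrix_def mat_def if_distrib if_distribR cong: if_cong)
qed

section \<open>Eigenvectors of a net-regular signed graph\<close>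

lemma adjacency_matrix_sym:
  assumes "signed_graph H"
  shows "adjacency_matrix H $ v $ w = adjacency_matrix H $ w $ v"
  using assms by (auto simp: adjacency_matrix_def signed_graph_def)

lemma net_regular_row_sum:
  assumes "signed_graph H" and "net_regular H d"
  shows "(\<Sum>w\<in>UNIV. adjacency_matrix H $ v $ w) = real_of_int d"
proof -
  let ?P = "{w. adj H v w \<and> esign H v w = 1}" and ?N = "{w. adj H v w \<and> esign H v w = -1}"
  \<comment> \<open>A difference of indicators, because summing an indicator gives a cardinality,
    here a degree.\<close>
  have "adjacency_matrix H $ v $ w = of_bool (w \<in> ?P) - of_bool (w \<in> ?N)" for w
    using assms(1) by (auto simp: adjacency_matrix_def signed_graph_def)
  then have "(\<Sum>w\<in>UNIV. adjacency_matrix H $ v $ w) = real (card ?P) - real (card ?N)"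
    by (simp add: sum_subtractf)
  also have "\<dots> = real_of_int (int (pos_degree H v) - int (neg_degree H v))"
    by (simp add: pos_degree_def neg_degree_def)
  finally show ?thesis
    unfolding assms(2)[unfolded net_regular_def, rule_format] .
qed

text \<open>Constant row sums make every constant vector an eigenvector for \<open>d\<close>. The
  plurality marking is constant, since the sign of \<open>d\<close> decides the mark at every node.
  For the canonical marking net-regularity does not imply the equation, so it is assumed.\<close>

lemma marking_eigenvector:
  assumes "signed_graph H" and "net_regular H d" and "marking_of H \<nu>"
    and "\<nu> = canonical_marking H \<longrightarrow>
           adjacency_matrix H *v (\<chi> v. \<nu> v) = real_of_int d *s (\<chi> v. \<nu> v)"
  shows "(\<Sum>w\<in>UNIV. adjacency_matrix H $ v $ w * \<nu> w) = real_of_int d * \<nu> v"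
proof (cases "\<nu> = canonical_marking H")
  case True
  then have "(adjacency_matrix H *v (\<chi> v. \<nu> v)) $ v = (real_of_int d *s (\<chi> v. \<nu> v)) $ v"
    using assms(4) by simp
  then show ?thesis
    by (simp add: matrix_vector_mult_def)
next
  case False
  have "pos_degree H w \<ge> neg_degree H w \<longleftrightarrow> d \<ge> 0" for w
    using assms(2)[unfolded net_regular_def, rule_format, of w] by linarith
  then have "\<nu> w = \<nu> v" for w
    using False assms(3) by (simp add: marking_of_def plurality_marking_def)
  then have "(\<Sum>w\<in>UNIV. adjacency_matrix H $ v $ w * \<nu> w)
      = (\<Sum>w\<in>UNIV. adjacency_matrix H $ v $ w) * \<nu> v"
    by (metis (no_types, lifting) sum.cong sum_distrib_right)
  then show ?thesis
    by (simp add: net_regular_row_sum[OF assms(1,2)])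
qed

text \<open>Eigenvectors of a symmetric matrix for distinct eigenvalues are orthogonal, and the
  all-ones vector is one for \<open>d\<close>.\<close>

lemma eigenvector_sum_eq_0:
  assumes "signed_graph H" and "net_regular H d"
    and "eigenpair (adjacency_matrix H) c y" and "c \<noteq> real_of_int d"
  shows "(\<Sum>v\<in>UNIV. y $ v) = 0"
proof -
  let ?A = "adjacency_matrix H"
  have y: "(\<Sum>w\<in>UNIV. ?A $ v $ w * y $ w) = c * y $ v" for v
    using assms(3) by (simp add: eigenpair_def matrix_vector_mult_def vec_eq_iff)
  have "c * (\<Sum>v\<in>UNIV. y $ v) = (\<Sum>v\<in>UNIV. \<Sum>w\<in>UNIV. ?A $ v $ w * y $ w)"
    by (simp add: y sum_distrib_left)
  also have "\<dots> = (\<Sum>w\<in>UNIV. \<Sum>v\<in>UNIV. ?A $ v $ w * y $ w)"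
    by (rule sum.swap)
  \<comment> \<open>Symmetry turns the column sums into row sums, all equal to
    \<open>d\<close>.\<close>
  also have "\<dots> = (\<Sum>w\<in>UNIV. (\<Sum>v\<in>UNIV. ?A $ w $ v) * y $ w)"
    by (simp add: sum_distrib_right adjacency_matrix_sym[OF assms(1)])
  also have "\<dots> = real_of_int d * (\<Sum>v\<in>UNIV. y $ v)"
    by (simp add: net_regular_row_sum[OF assms(1,2)] sum_distrib_left)
  finally show ?thesis
    using assms(4) by simp
qed

section \<open>The two families of eigenpairs of the corona product\<close>

lemma corona_eigenpair_root:
  fixes G :: "'a::finite sgraph" and H :: "'b::finite sgraph"
  assumes mu: "\<And>u. \<mu> u * \<mu> u = 1" and nu: "\<And>v. \<nu> v * \<nu> v = 1"
    and H: "\<And>v. (\<Sum>w\<in>UNIV. adjacency_matrix H $ v $ w * \<nu> w) = r * \<nu> v"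
    and x: "eigenpair (adjacency_matrix G) c x"
    and l: "(l - c) * (l - r) = real CARD('b)"
  shows "eigenpair (adjacency_matrix (corona G \<mu> H \<nu>)) l
    (stack x (blocks (\<lambda>v. (\<nu> v / (l - r)) *s (diag_matrix \<mu> *v x))))"
    (is "eigenpair ?M l (stack x (blocks ?f))")
proof -
  \<comment> \<open>The product in \<open>l\<close> equals \<open>CARD('b)\<close>, which is
    positive, so neither factor vanishes and the divisions by \<open>l - r\<close> are
    genuine.\<close>
  have lr: "l - r \<noteq> 0"
    using l by auto
  obtain u where "x $ u \<noteq> 0"
    using x by (auto simp: eigenpair_def vec_eq_iff)
  then have nz: "stack x (blocks ?f) \<noteq> 0"
    by (auto simp: vec_eq_iff intro: exI[of _ "Inl u"])
  have f: "?f v $ u = \<nu> v / (l - r) * (\<mu> u * x $ u)" for v u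
    by (simp add: diag_matrix_mult_vec_nth)
  have "(?M *v stack x (blocks ?f)) $ p = l * stack x (blocks ?f) $ p" for p
  proof (cases p)
    case (Inl u)
    have upper: "\<mu> u * (\<nu> v * ?f v $ u) = x $ u / (l - r)" for v
    proof -
      have "\<mu> u * (\<nu> v * ?f v $ u) = (\<mu> u * \<mu> u) * (\<nu> v * \<nu> v) * x $ u / (l - r)"
        unfolding f by (simp add: mult_ac)
      then show ?thesis
        by (simp add: mu nu)
    qed
    have "\<mu> u * (\<Sum>v\<in>UNIV. \<nu> v * ?f v $ u) = real CARD('b) * x $ u / (l - r)"
      unfolding sum_distrib_left upper by simp
    \<comment> \<open>The quadratic equation is read backwards: the number of nodes of
      \<open>H\<close> becomes a product whose factor \<open>l - r\<close> cancels.\<close>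
    also have "\<dots> = (l - c) * x $ u"
      unfolding l[symmetric] using lr by simp
    finally show ?thesis
      using x by (simp add: Inl corona_mult_stack_Inl eigenpair_def algebra_simps)
  next
    case (Inr q)
    obtain v u where q: "q = (v, u)"
      by (cases q)
    have "(\<Sum>w\<in>UNIV. adjacency_matrix H $ v $ w * ?f w $ u)
        = (\<Sum>w\<in>UNIV. adjacency_matrix H $ v $ w * \<nu> w) * (\<mu> u * x $ u) / (l - r)"
      unfolding f sum_distrib_right sum_divide_distrib by (simp add: mult_ac)
    then have "(?M *v stack x (blocks ?f)) $ Inr (v, u)
        = \<nu> v * (\<mu> u * x $ u) + r * \<nu> v * (\<mu> u * x $ u) / (l - r)"
      unfolding corona_mult_stack_Inr H by simp
    \<comment> \<open>This is \<open>1 + r / (l - r) = l / (l - r)\<close>.\<close>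
    also have "\<dots> = l * ?f v $ u"
      unfolding f using lr by (simp add: field_simps)
    finally show ?thesis
      by (simp add: Inr q)
  qed
  with nz show ?thesis
    by (simp add: eigenpair_def vec_eq_iff)
qed

text \<open>The zero sum cancels the contribution of the copies to the upper block, and the zero
  upper part leaves each copy of \<open>H\<close> to itself, where a multiple of \<open>y\<close> is
  an eigenvector.\<close>

lemma corona_eigenpair_lift:
  fixes G :: "'a::finite sgraph" and H :: "'b::finite sgraph"
  assumes y: "eigenpair (adjacency_matrix H) c y" and sum: "(\<Sum>v\<in>UNIV. \<nu> v * y $ v) = 0"
    and "x \<noteq> 0"
  shows "eigenpair (adjacency_matrix (corona G \<mu> H \<nu>)) c (stack 0 (kron_vec y x))"
    (is "eigenpair ?M c ?z")
proof -
  obtain v where "y $ v \<noteq> 0"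
    using y by (auto simp: eigenpair_def vec_eq_iff)
  moreover obtain u where "x $ u \<noteq> 0"
    using \<open>x \<noteq> 0\<close> by (auto simp: vec_eq_iff)
  ultimately have nz: "?z \<noteq> 0"
    by (auto simp: vec_eq_iff kron_vec_def intro!: exI[of _ "Inr (v, u)"])
  have Ay: "(\<Sum>w\<in>UNIV. adjacency_matrix H $ v $ w * y $ w) = c * y $ v" for v
    using y by (simp add: eigenpair_def matrix_vector_mult_def vec_eq_iff)
  have "(?M *v ?z) $ p = c * ?z $ p" for p
  proof (cases p)
    case (Inl u)
    have "(\<Sum>v\<in>UNIV. \<nu> v * (y $ v * x $ u)) = (\<Sum>v\<in>UNIV. \<nu> v * y $ v) * x $ u"
      unfolding sum_distrib_right by (simp add: mult_ac)
    then show ?thesis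
      by (simp add: Inl kron_vec_eq_blocks corona_mult_stack_Inl sum)
  next
    case (Inr q)
    obtain v u where q: "q = (v, u)"
      by (cases q)
    have "(\<Sum>w\<in>UNIV. adjacency_matrix H $ v $ w * (y $ w * x $ u)) = c * y $ v * x $ u"
      unfolding Ay[symmetric] sum_distrib_right by (simp add: mult_ac)
    then show ?thesis
      by (simp add: Inr q kron_vec_eq_blocks corona_mult_stack_Inr)
  qed
  with nz show ?thesis
    by (simp add: eigenpair_def vec_eq_iff)
qed

text \<open>The factor \<open>s\<close> covers both signs of the root. With \<open>t\<close> the
  signed root, the factors are \<open>(t + (a - b)) / 2\<close> and
  \<open>(t - (a - b)) / 2\<close>, so their product is a difference of squares.\<close>

lemma quadratic_root_product:
  fixes a b k s :: real
  assumes "s * s = 1" and "k \<ge> 0" and "l = (a + b + s * sqrt ((a - b)\<^sup>2 + 4 * k)) / 2"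
  shows "(l - b) * (l - a) = k"
proof -
  define t where "t = s * sqrt ((a - b)\<^sup>2 + 4 * k)"
  have "t * t = (s * s) * (sqrt ((a - b)\<^sup>2 + 4 * k))\<^sup>2"
    by (simp add: t_def power2_eq_square mult_ac)
  also have "\<dots> = (a - b)\<^sup>2 + 4 * k"
    using assms(1,2) by simp
  finally have t: "t * t = (a - b)\<^sup>2 + 4 * k" .
  have "4 * ((l - b) * (l - a)) = t * t - (a - b)\<^sup>2"
    unfolding assms(3) t_def[symmetric] by (simp add: power2_eq_square field_simps)
  with t show ?thesis
    by simp
qed

theorem theorem2:
  fixes G1 :: "'a::finite sgraph" and G2 :: "'b::finite sgraph"
    and mu1 :: "'a \<Rightarrow> real" and mu2 :: "'b \<Rightarrow> real" and d :: int
    and lam eta :: "nat \<Rightarrow> real" and X :: "nat \<Rightarrow> real^'a" and Y :: "nat \<Rightarrow> real^'b"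
  assumes "signed_graph G1" and "marking_of G1 mu1"
    and "signed_graph G2" and "marking_of G2 mu2"
    and "net_regular G2 d"
    and "mu2 = canonical_marking G2 \<longrightarrow>
           adjacency_matrix G2 *v (\<chi> v. mu2 v) = real_of_int d *s (\<chi> v. mu2 v)"
    and "\<forall>i\<in>{1..CARD('a)}. eigenpair (adjacency_matrix G1) (lam i) (X i)"
    and "\<forall>j\<in>{1..CARD('b)}. eigenpair (adjacency_matrix G2) (eta j) (Y j)"
    and "eta CARD('b) = real_of_int d"
    and "\<forall>j\<in>{1..CARD('b) - 1}. eta j = real_of_int d \<longrightarrow> orthogonal (Y j) (\<chi> v. 1)"
  shows "(\<forall>i\<in>{1..CARD('a)}. \<forall>s\<in>{1, -1}.
            let l = (real_of_int d + lam i
                      + s * sqrt ((real_of_int d - lam i)\<^sup>2 + 4 * real CARD('b))) / 2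
            in eigenpair (adjacency_matrix (corona G1 mu1 G2 mu2)) l
                 (stack (X i) (blocks (\<lambda>v. (mu2 v / (l - real_of_int d)) *s
                                             (diag_matrix mu1 *v X i))))) \<and>
         ((\<forall>v. mu2 v = 1) \<or> (\<forall>v. mu2 v = -1) \<longrightarrow>
            (\<forall>j\<in>{1..CARD('b) - 1}. \<forall>u.
               eigenpair (adjacency_matrix (corona G1 mu1 G2 mu2)) (eta j)
                 (stack 0 (kron_vec (Y j) (axis u 1)))))"
proof -
  have mu: "mu1 u * mu1 u = 1" for u
    using marking_of_values[OF assms(1,2), of u] by auto
  have nu: "mu2 v * mu2 v = 1" for v
    using marking_of_values[OF assms(3,4), of v] by auto
  note B = marking_eigenvector[OF assms(3,5,4,6)]
  have first: "eigenpair (adjacency_matrix (corona G1 mu1 G2 mu2)) l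
      (stack (X i) (blocks (\<lambda>v. (mu2 v / (l - real_of_int d)) *s (diag_matrix mu1 *v X i))))"
    if "i \<in> {1..CARD('a)}" and "s \<in> {1, -1}"
      and "l = (real_of_int d + lam i
            + s * sqrt ((real_of_int d - lam i)\<^sup>2 + 4 * real CARD('b))) / 2" for i s l
  proof (rule corona_eigenpair_root[OF mu nu B])
    show "eigenpair (adjacency_matrix G1) (lam i) (X i)"
      using assms(7) that(1) by blast
    show "(l - lam i) * (l - real_of_int d) = real CARD('b)"
      using that(2) by (intro quadratic_root_product[OF _ _ that(3)]) auto
  qed
  have second: "eigenpair (adjacency_matrix (corona G1 mu1 G2 mu2)) (eta j)
      (stack 0 (kron_vec (Y j) (axis u 1)))"
    if const: "(\<forall>v. mu2 v = 1) \<or> (\<forall>v. mu2 v = -1)" and j: "j \<in> {1..CARD('b) - 1}" for j u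
  proof (rule corona_eigenpair_lift)
    show y: "eigenpair (adjacency_matrix G2) (eta j) (Y j)"
      using assms(8) j by auto
    have "(\<Sum>v\<in>UNIV. Y j $ v) = 0"
    \<comment> \<open>If \<open>d\<close> is a multiple eigenvalue, \<open>eta j = d\<close> can
      also occur for \<open>j\<close> below \<open>CARD('b)\<close>. Symmetry then says nothing
      about \<open>Y j\<close>, and the assumed orthogonality to the all-ones vector takes
      over.\<close>
    proof (cases "eta j = real_of_int d")
      case True
      then have "orthogonal (Y j) (\<chi> v. 1)"
        using assms(10) j by blast
      then show ?thesis
        by (simp add: orthogonal_def inner_vec_def)
    qed (rule eigenvector_sum_eq_0[OF assms(3,5) y])
    \<comment> \<open>With constant marks the weighted sum is the plain sum up to sign.\<close>
    then show "(\<Sum>v\<in>UNIV. mu2 v * Y j $ v) = 0"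
      using const by (auto simp: sum_negf)
    show "axis u (1::real) \<noteq> 0"
      by (simp add: axis_eq_0_iff)
  qed
  show ?thesis
    unfolding Let_def using first second by blast
qed

end
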